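(* Let $a \in \mathcal R$ and let $J_a^L, J_a^R$, $M$ and $N$ be as defined in the context. For each $\alpha \in J_a^L$ the map $T_\alpha$ satisfies $T_\alpha^M(\alpha) = T_\alpha^N(1-\alpha)$, and for each $\alpha \in J_a^R$ the map $T_\alpha$ satisfies $T_\alpha^{M+1}(\alpha) = T_\alpha^{N-1}(1-\alpha)$.
   Context: $[a_1,a_2,\ldots]$ denotes the (finite or infinite) regular continued fraction $\cfrac{1}{a_1+\cfrac{1}{a_2+\cdots}}$ and an overline denotes a periodically repeated block. For $\alpha \in (0,1)$ let $D_\alpha = \bigcup_{n \ge 1} \big[ \frac{1}{n+\alpha}, \frac1n \big]$, $D_\alpha^{\mathsf c} = [0,1]\setminus D_\alpha$, $I_\alpha = [\min\{\alpha,1-\alpha\},1]$, and $T_\alpha : I_\alpha \to I_\alpha$, $T_\alpha(x) = \frac1x - \lfloor \frac1x \rfloor$ if $x \in D_\alpha^{\mathsf c}$, $T_\alpha(x) = 1 + \lfloor \frac1x \rfloor - \frac1x$ if $x \in D_\alpha$. Let $g=\frac{\sqrt5-1}{2}$. Each rational $a\in\mathbb Q\cap(0,1)$ has two expansions $a=[a_1,\ldots,a_n]=[a_1,\ldots,a_n-1,1]$ with $a_n\ge2$; its quadratic interval $I_a$ is the open interval with endpoints $[\overline{a_1,\ldots,a_n}]$ and $[\overline{a_1,\ldots,a_n-1,1}]$, and $I_1 := (g,1)$. A quadratic interval is maximal if it is not properly contained in any other quadratic interval, and $\mathcal R = \{a \in \mathbb Q\cap(0,1] : I_a \text{ is maximal}\}$.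 For $a=[a_1,\ldots,a_n]\in\mathcal R\setminus\{1\}$ with $a_n\ge2$: if $n$ is odd, $J_a^L = ([1,\overline{a_1,\ldots,a_n-1,1}],[1,a_1,\ldots,a_n-1,1])$, $J_a^R = ([1,a_1,\ldots,a_n],[1,\overline{a_1,\ldots,a_n}])$, $M = a_1+a_3+\cdots+a_n$, $N = a_2+a_4+\cdots+a_{n-1}+2$; if $n$ is even, $J_a^L = ([1,\overline{a_1,\ldots,a_n}],[1,a_1,\ldots,a_n])$, $J_a^R = ([1,a_1,\ldots,a_n-1,1],[1,\overline{a_1,\ldots,a_n-1,1}])$, $M = a_1+a_3+\cdots+a_{n-1}+1$, $N = a_2+a_4+\cdots+a_n+1$. For $a=1$: $J_1^L=\emptyset$, $J_1^R=(\frac12,g)$, $M=1$, $N=2$. *)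

theory Defs
  imports Complex_Main
begin

fun cf_fin :: "nat list \<Rightarrow> real" where
  "cf_fin [] = 0"
| "cf_fin (x # xs) = 1 / (real x + cf_fin xs)"

definition cf_inf :: "(nat \<Rightarrow> nat) \<Rightarrow> real" where
  "cf_inf f = lim (\<lambda>m. cf_fin (map f [0..<m]))"

definition cf_per :: "nat list \<Rightarrow> real" where
  "cf_per xs = cf_inf (\<lambda>k. xs ! (k mod length xs))"

definition gold :: real where
  "gold = (sqrt 5 - 1) / 2"

definition cfexp :: "real \<Rightarrow> nat list" where
  "cfexp a = (THE xs. xs \<noteq> [] \<and> (\<forall>x\<in>set xs. 0 < x) \<and> 2 \<le> last xs \<and> cf_fin xs = a)"

definition alt_exp :: "nat list \<Rightarrow> nat list" where
  "alt_exp xs = butlast xs @ [last xs - 1, 1]"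

definition open_int :: "real \<Rightarrow> real \<Rightarrow> real set" where
  "open_int x y = {min x y <..< max x y}"

definition qint :: "real \<Rightarrow> real set" where
  "qint a = (if a = 1 then {gold <..< 1}
             else open_int (cf_per (cfexp a)) (cf_per (alt_exp (cfexp a))))"

definition Rset :: "real set" where
  "Rset = {a. a \<in> \<rat> \<and> 0 < a \<and> a \<le> 1 \<and>
              \<not> (\<exists>b. b \<in> \<rat> \<and> 0 < b \<and> b \<le> 1 \<and> qint a \<subset> qint b)}"

definition one_per :: "nat list \<Rightarrow> real" where
  "one_per xs = 1 / (1 + cf_per xs)"

definition one_fin :: "nat list \<Rightarrow> real" where
  "one_fin xs = cf_fin (1 # xs)"

definition JL :: "real \<Rightarrow> real set" where
  "JL a = (if a = 1 then {} else
     (let xs = cfexp a in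
      if odd (length xs) then open_int (one_per (alt_exp xs)) (one_fin (alt_exp xs))
      else open_int (one_per xs) (one_fin xs)))"

definition JR :: "real \<Rightarrow> real set" where
  "JR a = (if a = 1 then {1/2 <..< gold} else
     (let xs = cfexp a in
      if odd (length xs) then open_int (one_fin xs) (one_per xs)
      else open_int (one_fin (alt_exp xs)) (one_per (alt_exp xs))))"

text \<open>Sums of a_1 + a_3 + ... (odd 1-based positions) and a_2 + a_4 + ... (even 1-based positions).\<close>
definition sum_odd_pos :: "nat list \<Rightarrow> nat" where
  "sum_odd_pos xs = (\<Sum>i\<in>{i. i < length xs \<and> even i}. xs ! i)"

definition sum_even_pos :: "nat list \<Rightarrow> nat" where
  "sum_even_pos xs = (\<Sum>i\<in>{i. i < length xs \<and> odd i}. xs ! i)"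

definition Mv :: "real \<Rightarrow> nat" where
  "Mv a = (if a = 1 then 1 else
     (let xs = cfexp a in
      if odd (length xs) then sum_odd_pos xs else sum_odd_pos xs + 1))"

definition Nv :: "real \<Rightarrow> nat" where
  "Nv a = (if a = 1 then 2 else
     (let xs = cfexp a in
      if odd (length xs) then sum_even_pos xs + 2 else sum_even_pos xs + 1))"

definition Dset :: "real \<Rightarrow> real set" where
  "Dset \<alpha> = (\<Union>n\<in>{1::nat..}. {1 / (real n + \<alpha>) .. 1 / real n})"

definition T :: "real \<Rightarrow> real \<Rightarrow> real" where
  "T \<alpha> x = (if x \<in> Dset \<alpha> then 1 + of_int \<lfloor>1/x\<rfloor> - 1/x
             else 1/x - of_int \<lfloor>1/x\<rfloor>)"

end

theory Submission
  imports Defs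
begin

text \<open>
  Write \<open>\<alpha> = 1 / (1 + t)\<close>. Then \<open>\<alpha>\<close> lies in \<open>J\<^sub>a\<^sup>L\<close> (resp. \<open>J\<^sub>a\<^sup>R\<close>) iff \<open>t = [w, s]\<close> with \<open>0 < s < t\<close>,
  where \<open>w\<close> is the expansion of \<open>a\<close> of even (resp. odd) length. As long as every tail of
  \<open>t\<close> is at least \<open>t\<close>, the orbit of \<open>\<alpha>\<close> under \<open>T\<^sub>\<alpha>\<close> runs through the numbers \<open>1 - [b, x]\<close>,
  where \<open>[b, x]\<close> is a tail of \<open>t\<close> starting at an odd position and \<open>b\<close> counts down by one in each step,
  and the orbit of \<open>1 - \<alpha>\<close> does the same with the tails starting at even positions. Both orbits
  meet at \<open>1 - s\<close>. If a proper tail of \<open>t\<close> were smaller than \<open>t\<close>, then \<open>t\<close> would lie in the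
  quadratic interval of a proper prefix of \<open>w\<close>, and for the shortest such prefix this interval
  would properly contain \<open>I\<^sub>a\<close>, which maximality excludes.
\<close>

section \<open>Continued fractions with a tail\<close>

fun cf_tail :: "nat list \<Rightarrow> real \<Rightarrow> real" where
  "cf_tail [] y = y"
| "cf_tail (x # xs) y = 1 / (real x + cf_tail xs y)"

abbreviation positive :: "nat list \<Rightarrow> bool" where
  "positive xs \<equiv> \<forall>x\<in>set xs. 0 < x"

lemma cf_fin_conv_tail: "cf_fin xs = cf_tail xs 0"
  by (induction xs) auto

lemma cf_tail_append: "cf_tail (xs @ ys) y = cf_tail xs (cf_tail ys y)"
  by (induction xs) auto

lemma cf_tail_take_drop: "cf_tail (take i xs) (cf_tail (drop i xs) y) = cf_tail xs y"
  by (simp flip: cf_tail_append)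

lemma cf_tail_nonneg: "0 \<le> y \<Longrightarrow> 0 \<le> cf_tail xs y"
  by (induction xs) auto

lemma cf_tail_pos:
  assumes "positive xs" "0 \<le> y" "xs \<noteq> [] \<or> 0 < y"
  shows "0 < cf_tail xs y"
  using assms cf_tail_nonneg[of y] by (cases xs) (auto intro!: add_pos_nonneg)

lemma cf_tail_le_1:
  assumes "positive xs" "0 \<le> y" "y \<le> 1"
  shows "cf_tail xs y \<le> 1"
proof (cases xs)
  case (Cons x ys)
  then have "1 \<le> real x + cf_tail ys y"
    using assms cf_tail_nonneg[of y ys] by (auto simp: Suc_le_eq intro!: add_increasing2)
  then show ?thesis using Cons by simp
qed (use assms in auto)

lemma cf_tail_less_1:
  assumes "positive xs" "0 < y" "y < 1"
  shows "cf_tail xs y < 1"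
proof (cases xs)
  case (Cons x ys)
  then have "1 \<le> real x" "0 < cf_tail ys y"
    using assms cf_tail_pos[of ys y] by (auto simp: Suc_le_eq)
  then show ?thesis using Cons by simp
qed (use assms in auto)

lemma cf_tail_inj:
  assumes "positive xs" "0 \<le> x" "0 \<le> y" "cf_tail xs x = cf_tail xs y"
  shows "x = y"
  using assms
proof (induction xs)
  case (Cons k ks)
  have "0 < real k + cf_tail ks x" "0 < real k + cf_tail ks y"
    using Cons.prems cf_tail_nonneg[of _ ks] by (auto intro!: add_pos_nonneg)
  then show ?case using Cons by (auto simp: divide_simps)
qed auto

text \<open>Each entry contributes one order-reversing map \<open>1 / (k + _)\<close>, so the parity
  of the length decides the direction.\<close>

lemma cf_tail_mono_iff:
  assumes "positive xs" "0 \<le> x" "0 \<le> y"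
  shows "cf_tail xs x < cf_tail xs y \<longleftrightarrow> (if even (length xs) then x < y else y < x)"
  using assms
proof (induction xs)
  case (Cons k ks)
  have "0 < real k + cf_tail ks x" "0 < real k + cf_tail ks y"
    using Cons.prems cf_tail_nonneg[of _ ks] by (auto intro!: add_pos_nonneg)
  then have "cf_tail (k # ks) x < cf_tail (k # ks) y \<longleftrightarrow> cf_tail ks y < cf_tail ks x"
    by (simp add: divide_simps)
  moreover have "cf_tail ks x = cf_tail ks y \<Longrightarrow> x = y"
    using Cons.prems cf_tail_inj[of ks x y] by auto
  moreover have "x = y \<Longrightarrow> cf_tail ks x = cf_tail ks y" by simp
  ultimately show ?case using Cons.IH Cons.prems
    by (smt (verit, ccfv_threshold) even_Suc length_Cons list.set_intros(2))
qed auto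

section \<open>Contraction estimates\<close>

lemma cf_step_contract:
  fixes k a b :: real
  assumes "1 \<le> k" "0 \<le> a" "0 \<le> b" "a \<noteq> b"
  shows "\<bar>1 / (k + a) - 1 / (k + b)\<bar> < \<bar>a - b\<bar>"
proof -
  have "1 < (k + a) * (k + b)"
  proof (cases "a = 0")
    case True
    then have "1 < k + b" "1 \<le> k + a" using assms by auto
    then show ?thesis by (smt (verit) mult_le_cancel_right1)
  next
    case False
    then have "1 \<le> k + b" "1 < k + a" using assms by auto
    then show ?thesis by (smt (verit) mult_le_cancel_left1)
  qed
  moreover have "1 / (k + a) - 1 / (k + b) = (b - a) / ((k + a) * (k + b))"
    using assms by (simp add: field_simps)
  ultimately show ?thesis using assms
    by (simp add: abs_mult divide_less_eq abs_minus_commute)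
qed

text \<open>Used with a fixed point as \<open>y\<close>: strictness puts \<open>cf_tail xs x\<close>
  nearer to it than \<open>x\<close>.\<close>

lemma cf_tail_contract:
  assumes "positive xs" "xs \<noteq> []" "0 \<le> x" "0 \<le> y" "x \<noteq> y"
  shows "\<bar>cf_tail xs x - cf_tail xs y\<bar> < \<bar>x - y\<bar>"
  using assms
proof (induction xs)
  case (Cons k ks)
  have ne: "cf_tail ks x \<noteq> cf_tail ks y" using Cons.prems cf_tail_inj[of ks x y] by auto
  have "1 \<le> real k" using Cons.prems by (simp add: Suc_le_eq)
  then have "\<bar>cf_tail (k # ks) x - cf_tail (k # ks) y\<bar> < \<bar>cf_tail ks x - cf_tail ks y\<bar>"
    using cf_step_contract[OF _ _ _ ne] Cons.prems cf_tail_nonneg by simp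
  also have "\<dots> \<le> \<bar>x - y\<bar>"
    using Cons by (cases "ks = []") auto
  finally show ?case .
qed auto

text \<open>A single step has no uniform rate when \<open>k = 1\<close> and the arguments are near
  0. Over two steps both factors of the denominator are at least 2.\<close>

lemma cf_two_steps_contract:
  fixes k l a b :: real
  assumes "1 \<le> k" "1 \<le> l" "0 \<le> a" "0 \<le> b"
  shows "\<bar>1 / (k + 1 / (l + a)) - 1 / (k + 1 / (l + b))\<bar> \<le> \<bar>a - b\<bar> / 4"
proof -
  have p: "1 \<le> k * (l + a)" "1 \<le> k * (l + b)"
    using assms by (smt (verit) mult_le_cancel_left1)+
  have eq: "1 / (k + 1 / (l + c)) = (l + c) / (k * (l + c) + 1)" if "0 \<le> c" for c
    using that assms by (simp add: field_simps)
  have "(l + a) / (k * (l + a) + 1) - (l + b) / (k * (l + b) + 1)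
      = (a - b) / ((k * (l + a) + 1) * (k * (l + b) + 1))"
    using p by (simp add: divide_simps) (simp add: algebra_simps)
  moreover have "2 * 2 \<le> (k * (l + a) + 1) * (k * (l + b) + 1)"
    using p by (intro mult_mono) auto
  ultimately have "\<bar>1 / (k + 1 / (l + a)) - 1 / (k + 1 / (l + b))\<bar>
      = \<bar>a - b\<bar> / ((k * (l + a) + 1) * (k * (l + b) + 1))"
    using p assms by (simp add: eq abs_mult)
  also have "\<dots> \<le> \<bar>a - b\<bar> / 4"
    using \<open>2 * 2 \<le> _\<close> by (intro divide_left_mono) auto
  finally show ?thesis .
qed

lemma cf_tail_geometric:
  assumes "positive xs" "0 \<le> x" "0 \<le> y"
  shows "\<bar>cf_tail xs x - cf_tail xs y\<bar> \<le> (1/4) ^ (length xs div 2) * \<bar>x - y\<bar>"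
  using assms
proof (induction xs rule: induct_list012)
  case (2 k)
  then have "1 \<le> real k" by (simp add: Suc_le_eq)
  then show ?case using cf_step_contract[of k x y] 2 by (cases "x = y") auto
next
  case (3 k l ks)
  have "1 \<le> real k" "1 \<le> real l" using 3 by (auto simp: Suc_le_eq)
  then have "\<bar>cf_tail (k # l # ks) x - cf_tail (k # l # ks) y\<bar> \<le> \<bar>cf_tail ks x - cf_tail ks y\<bar> / 4"
    using cf_two_steps_contract[of k l] 3 cf_tail_nonneg by simp
  also have "\<dots> \<le> (1/4) ^ (length ks div 2) * \<bar>x - y\<bar> / 4" using 3 by simp
  finally show ?case by simp
qed auto

lemma continuous_on_cf_tail:
  assumes "positive xs"
  shows "continuous_on {0..} (cf_tail xs)"
  using assms
proof (induction xs)
  case (Cons k ks)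
  have "real k + cf_tail ks x \<noteq> 0" if "x \<in> {0..}" for x
    using that Cons.prems cf_tail_nonneg[of x ks] by auto
  then show ?case using Cons by (auto intro!: continuous_intros)
qed (auto intro!: continuous_intros)

section \<open>Periodic continued fractions\<close>

text \<open>\<open>lim\<close> gives information only after convergence is shown. A fixed point
  \<open>b\<close> first comes from the intermediate value theorem; then the truncations are shown
  to converge to it.\<close>

lemma cf_per_props:
  assumes "positive xs" "xs \<noteq> []"
  shows cf_per_fixpoint: "cf_tail xs (cf_per xs) = cf_per xs"
    and cf_per_pos: "0 < cf_per xs"
    and cf_per_less_1: "cf_per xs < 1"
proof -
  let ?f = "\<lambda>k. xs ! (k mod length xs)"
  have "continuous_on {0..1} (\<lambda>x. cf_tail xs x - x)"
    by (intro continuous_intros continuous_on_subset[OF continuous_on_cf_tail]) (use assms in auto)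
  moreover have "cf_tail xs 1 - 1 \<le> 0" "0 \<le> cf_tail xs 0 - 0"
    using assms cf_tail_le_1[of xs 1] cf_tail_nonneg[of 0 xs] by auto
  ultimately obtain b where b: "0 \<le> b" "b \<le> 1" "cf_tail xs b - b = 0"
    using IVT2'[of "\<lambda>x. cf_tail xs x - x" 1 0 0] by auto
  have fp: "cf_tail xs b = b" using b by simp
  \<comment> \<open>Unrolling \<open>b\<close> for \<open>m\<close> entries leaves the rest of the
    current period as a remainder in [0,1]. The truncation puts 0 in its place, so the geometric
    bound applies.\<close>
  have expand: "cf_tail (map ?f [0..<m]) (cf_tail (drop (m mod length xs) xs) b) = b" for m
  proof (induction m)
    case (Suc m)
    let ?i = "m mod length xs"
    have i: "?i < length xs" using assms by simp
    have *: "cf_tail (drop (Suc m mod length xs) xs) b = cf_tail (drop (Suc ?i) xs) b"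
      using i fp by (cases "Suc ?i = length xs") (auto simp: mod_Suc)
    have "drop ?i xs = xs ! ?i # drop (Suc ?i) xs" using i by (simp add: Cons_nth_drop_Suc)
    then show ?case using Suc * by (simp add: cf_tail_append)
  qed (use fp in simp)
  have bound: "norm (cf_fin (map ?f [0..<m]) - b) \<le> (1/4) ^ (m div 2)" for m
  proof -
    let ?r = "cf_tail (drop (m mod length xs) xs) b"
    have pos: "positive (map ?f [0..<m])" using assms by auto
    have sub: "positive (drop (m mod length xs) xs)" using assms by (meson in_set_dropD)
    have r: "0 \<le> ?r" "?r \<le> 1"
      using b sub cf_tail_nonneg cf_tail_le_1 by auto
    have "\<bar>cf_tail (map ?f [0..<m]) 0 - cf_tail (map ?f [0..<m]) ?r\<bar> \<le> (1/4) ^ (m div 2) * \<bar>0 - ?r\<bar>"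
      using cf_tail_geometric[OF pos _ r(1), of 0] by simp
    also have "\<dots> \<le> (1/4) ^ (m div 2)" using r by (simp add: mult_left_le)
    finally show ?thesis unfolding expand by (simp add: cf_fin_conv_tail)
  qed
  have "(\<lambda>m. (1/4 :: real) ^ (m div 2)) \<longlonglongrightarrow> 0"
    by (rule filterlim_compose[OF LIMSEQ_power_zero filterlim_at_top_div_const_nat]) auto
  then have "(\<lambda>m. cf_fin (map ?f [0..<m]) - b) \<longlonglongrightarrow> 0"
    by (rule tendsto_0_le[where K = 1]) (use bound in \<open>auto intro!: always_eventually\<close>)
  then have "(\<lambda>m. cf_fin (map ?f [0..<m])) \<longlonglongrightarrow> b" by (simp add: LIM_zero_iff)
  then have [simp]: "cf_per xs = b" unfolding cf_per_def cf_inf_def by (rule limI)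
  show "cf_tail xs (cf_per xs) = cf_per xs" using fp by simp
  have "0 < b" using cf_tail_pos[of xs b] assms b fp by auto
  then show "0 < cf_per xs" by simp
  obtain k ks where ks: "xs = k # ks" using assms by (cases xs) auto
  have "1 \<le> real k" "0 < cf_tail ks b" using ks assms \<open>0 < b\<close> cf_tail_pos[of ks b]
    by (auto simp: Suc_le_eq)
  then have "1 / (real k + cf_tail ks b) < 1" by simp
  then have "b < 1" using fp ks by simp
  then show "cf_per xs < 1" by simp
qed

lemma cf_fin_less_cf_per_iff:
  assumes "positive xs" "xs \<noteq> []"
  shows "cf_fin xs < cf_per xs \<longleftrightarrow> even (length xs)"
    and "cf_per xs < cf_fin xs \<longleftrightarrow> odd (length xs)"
  using cf_tail_mono_iff[OF assms(1), of 0 "cf_per xs"] cf_tail_mono_iff[OF assms(1), of "cf_per xs" 0]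
    cf_per_props[OF assms] by (auto simp: cf_fin_conv_tail)

section \<open>Numbers with a prescribed prefix and a smaller remainder\<close>

lemma open_int_subset_open_int:
  assumes "c \<notin> open_int x y" "d \<notin> open_int x y" "open_int c d \<inter> open_int x y \<noteq> {}"
  shows "open_int x y \<subseteq> open_int c d"
proof -
  obtain z where "min c d < z" "z < max c d" "min x y < z" "z < max x y"
    using assms(3) unfolding open_int_def ex_in_conv[symmetric] Int_iff greaterThanLessThan_iff by blast
  then have "min c d \<le> min x y" "max x y \<le> max c d"
    using assms(1,2) unfolding open_int_def greaterThanLessThan_iff by linarith+
  then show ?thesis by (auto simp: open_int_def)
qed

text \<open>The part of the quadratic interval of \<open>[u]\<close> on one side of \<open>[u]\<close>; the parity of the length of
  \<open>u\<close> selects the side.\<close>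

definition half_int :: "nat list \<Rightarrow> real set" where
  "half_int u = open_int (cf_fin u) (cf_per u)"

text \<open>The intermediate value theorem gives a remainder \<open>s\<close> below the fixed point
  \<open>cf_per u\<close>. Since \<open>t\<close> is nearer to that fixed point than
  \<open>s\<close>, the condition \<open>s < cf_per u\<close> is the same as
  \<open>s < t\<close>.\<close>

lemma half_int_iff:
  assumes u: "positive u" "u \<noteq> []"
  shows "t \<in> half_int u \<longleftrightarrow> (\<exists>s. 0 < s \<and> s < t \<and> t = cf_tail u s)"
proof
  define b where "b = cf_per u"
  have b: "cf_tail u b = b" "0 < b" "b < 1" using cf_per_props[OF u] by (auto simp: b_def)
  note mono = cf_tail_mono_iff[OF u(1)]
  {
    assume t: "t \<in> half_int u"
    have cont: "continuous_on {0..b} (cf_tail u)"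
      using continuous_on_subset[OF continuous_on_cf_tail[OF u(1)]] by auto
    have "\<exists>s. 0 < s \<and> s < b \<and> cf_tail u s = t"
    proof (cases "even (length u)")
      case True
      then have "cf_tail u 0 < t" "t < cf_tail u b"
        using t mono[of 0 b] b by (auto simp: half_int_def open_int_def b_def cf_fin_conv_tail)
      moreover from this obtain s where "0 \<le> s" "s \<le> b" "cf_tail u s = t"
        using IVT'[of "cf_tail u" 0 t b] cont b by auto
      ultimately show ?thesis by (metis less_le)
    next
      case False
      then have "t < cf_tail u 0" "cf_tail u b < t"
        using t mono[of b 0] b by (auto simp: half_int_def open_int_def b_def cf_fin_conv_tail)
      moreover from this obtain s where "0 \<le> s" "s \<le> b" "cf_tail u s = t"
        using IVT2'[of "cf_tail u" b t 0] cont b by auto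
      ultimately show ?thesis by (metis less_le)
    qed
    then obtain s where s: "0 < s" "s < b" "cf_tail u s = t" by blast
    have "s < t"
      using cf_tail_contract[OF u, of s b] mono[of s b] mono[of b s] s b by (auto split: if_splits)
    then show "\<exists>s. 0 < s \<and> s < t \<and> t = cf_tail u s" using s by blast
  }
  {
    assume "\<exists>s. 0 < s \<and> s < t \<and> t = cf_tail u s"
    then obtain s where s: "0 < s" "s < t" "t = cf_tail u s" by blast
    have "s < b"
      using cf_tail_contract[OF u, of s b] mono[of s b] mono[of b s] s b
      by (cases s b rule: linorder_cases) (auto split: if_splits)
    then show "t \<in> half_int u"
      using s b mono[of 0 s] mono[of s 0] mono[of s b] mono[of b s]
      by (cases "even (length u)")
        (auto simp: half_int_def open_int_def cf_fin_conv_tail min_def max_def simp flip: b_def)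
  }
qed

text \<open>Uniqueness of expansions: the entries of \<open>q\<close> are matched one by one with
  those of the period, so what remains after \<open>q\<close> is again a tail of the periodic
  number.\<close>

lemma cf_tail_eq_periodic_tail:
  assumes u: "positive u" "b = cf_tail u b" "0 < b" "b < 1" "i < length u"
    and q: "positive q" "0 \<le> y" "y \<le> 1"
    and eq: "cf_tail (drop i u) b = cf_tail q y"
  shows "\<exists>j<length u. y = cf_tail (drop j u) b"
  using q eq u(5)
proof (induction q arbitrary: i)
  case (Cons k q)
  define z where "z = cf_tail (drop (Suc i) u) b"
  define z' where "z' = cf_tail q y"
  have "positive (drop (Suc i) u)" using u(1) by (meson in_set_dropD)
  then have z: "0 < z" "z < 1"
    using cf_tail_pos[of "drop (Suc i) u" b] cf_tail_less_1[of "drop (Suc i) u" b] u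
    by (auto simp: z_def)
  have z': "0 \<le> z'" "z' \<le> 1"
    using cf_tail_nonneg cf_tail_le_1 Cons.prems by (auto simp: z'_def)
  have "0 < real (u ! i)" "0 < real k" using u(1) Cons.prems by auto
  moreover have "1 / (real (u ! i) + z) = 1 / (real k + z')"
    using Cons.prems by (simp add: z_def z'_def flip: Cons_nth_drop_Suc)
  ultimately have sum: "real (u ! i) + z = real k + z'" using z z' by (simp add: field_simps)
  \<comment> \<open>\<open>z'\<close> may be 0 or 1, but \<open>z\<close> is strictly between them,
    so the integer parts still agree.\<close>
  have "real (u ! i) < real (Suc k)" "real k < real (Suc (u ! i))"
    using sum z z' by linarith+
  then have "u ! i = k" unfolding of_nat_less_iff by linarith
  then have zz: "z = z'" using sum by simp
  show ?case
  proof (cases "Suc i = length u")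
    case True
    \<comment> \<open>The period is used up; the fixed-point equation restarts it at index
      0.\<close>
    then have "cf_tail (drop 0 u) b = cf_tail q y" using zz u(2) by (simp add: z_def z'_def)
    then show ?thesis using Cons True by (intro Cons.IH[of 0]) auto
  next
    case False
    then show ?thesis using Cons zz by (intro Cons.IH[of "Suc i"]) (auto simp: z_def z'_def)
  qed
qed auto

section \<open>Expansions of rationals\<close>

definition is_cfexp :: "nat list \<Rightarrow> bool" where
  "is_cfexp xs \<longleftrightarrow> xs \<noteq> [] \<and> positive xs \<and> 2 \<le> last xs"

lemma is_cfexp_cf_fin_less_1:
  assumes "is_cfexp xs"
  shows "cf_fin xs < 1"
proof -
  obtain k ks where xs: "xs = k # ks" using assms by (cases xs) (auto simp: is_cfexp_def)
  have "1 < real k + cf_fin ks"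
  proof (cases "ks = []")
    case True
    then show ?thesis using assms xs by (simp add: is_cfexp_def)
  next
    case False
    then have "0 < cf_fin ks" "1 \<le> real k"
      using assms xs cf_tail_pos[of ks 0] by (auto simp: is_cfexp_def cf_fin_conv_tail Suc_le_eq)
    then show ?thesis by simp
  qed
  then show ?thesis using xs by simp
qed

text \<open>A last entry of at least 2 keeps every tail below 1, so the first entry is the integer
  part of the reciprocal.\<close>

lemma is_cfexp_unique:
  assumes "is_cfexp xs" "is_cfexp ys" "cf_fin xs = cf_fin ys"
  shows "xs = ys"
  using assms
proof (induction xs arbitrary: ys)
  case (Cons k ks)
  obtain l ls where ys: "ys = l # ls" using Cons.prems by (cases ys) (auto simp: is_cfexp_def)
  have tail: "0 \<le> cf_fin zs \<and> cf_fin zs < 1 \<and> (zs \<noteq> [] \<longrightarrow> 0 < cf_fin zs \<and> is_cfexp zs)"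
    if "is_cfexp (m # zs)" for m zs
    using that is_cfexp_cf_fin_less_1[of zs] cf_tail_pos[of zs 0]
    by (cases "zs = []") (auto simp: is_cfexp_def cf_fin_conv_tail)
  have t: "0 \<le> cf_fin ks" "cf_fin ks < 1" "0 \<le> cf_fin ls" "cf_fin ls < 1"
    using tail Cons.prems ys by blast+
  have "0 < real k" "0 < real l" using Cons.prems ys by (auto simp: is_cfexp_def)
  moreover have "1 / (real k + cf_fin ks) = 1 / (real l + cf_fin ls)"
    using Cons.prems ys by simp
  ultimately have sum: "real k + cf_fin ks = real l + cf_fin ls"
    using t by (simp add: field_simps)
  have "real k < real (Suc l)" "real l < real (Suc k)" using sum t by linarith+
  then have kl: "k = l" unfolding of_nat_less_iff by linarith
  then have eq: "cf_fin ks = cf_fin ls" using sum by simp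
  have "ks = ls"
  proof (cases "ks = [] \<or> ls = []")
    case True
    then show ?thesis using eq tail Cons.prems ys by fastforce
  next
    case False
    then show ?thesis using eq tail Cons ys by metis
  qed
  then show ?case using ys kl by simp
qed (simp add: is_cfexp_def)

text \<open>Euclidean algorithm: \<open>p / q = 1 / (k + r / p)\<close>, where \<open>r / p\<close>
  has the smaller denominator.\<close>

lemma is_cfexp_exists_fraction:
  assumes "0 < p" "p < q"
  shows "\<exists>xs. is_cfexp xs \<and> cf_fin xs = real p / real q"
  using assms
proof (induction q arbitrary: p rule: less_induct)
  case (less q)
  define k r where "k = q div p" and "r = q mod p"
  have q: "q = k * p + r" and r: "r < p" using less.prems by (auto simp: k_def r_def)
  have k: "0 < k" using less.prems by (simp add: k_def div_greater_zero_iff)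
  show ?case
  proof (cases "r = 0")
    case True
    then have "2 \<le> k" using q k less.prems by (cases "k = 1") auto
    then show ?thesis using True q less.prems
      by (intro exI[of _ "[k]"]) (auto simp: is_cfexp_def)
  next
    case False
    then obtain xs where xs: "is_cfexp xs" "cf_fin xs = real r / real p"
      using less.IH[of p r] r less.prems by auto
    have "cf_fin (k # xs) = real p / real q"
    proof -
      have "real p \<noteq> 0" "0 < real k + real r / real p" using less.prems k by (auto intro!: add_pos_nonneg)
      then show ?thesis using xs by (simp add: q) (simp add: field_simps)
    qed
    then show ?thesis using xs k
      by (intro exI[of _ "k # xs"]) (auto simp: is_cfexp_def)
  qed
qed

lemma cfexp_cf_fin:
  assumes "is_cfexp xs"
  shows "cfexp (cf_fin xs) = xs"
  unfolding cfexp_def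
  by (rule the_equality) (use assms is_cfexp_unique in \<open>auto simp: is_cfexp_def\<close>)

lemma cfexp_props:
  assumes "a \<in> \<rat>" "0 < a" "a < 1"
  shows "is_cfexp (cfexp a) \<and> cf_fin (cfexp a) = a"
proof -
  obtain m n where "n \<noteq> 0" "\<bar>a\<bar> = real m / real n" using Rats_abs_nat_div_natE[OF assms(1)] by metis
  then have a: "a = real m / real n" "0 < n" using assms by auto
  then have "0 < real m" "real m < real n" using assms by (auto simp: zero_less_divide_iff)
  then have "0 < m" "m < n" by auto
  then show ?thesis using is_cfexp_exists_fraction[of m n] cfexp_cf_fin a by metis
qed

lemma cf_fin_Rats: "cf_fin xs \<in> \<rat>"
  by (induction xs) auto

lemma is_cfexp_snocE:
  assumes "is_cfexp xs"
  obtains p d where "xs = p @ [d]" "2 \<le> d" "positive p" "alt_exp xs = p @ [d - 1, 1]"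
  using assms by (cases xs rule: rev_cases) (auto simp: is_cfexp_def alt_exp_def)

lemma cf_fin_alt_exp:
  assumes "is_cfexp xs"
  shows "cf_fin (alt_exp xs) = cf_fin xs"
proof -
  obtain p d where "xs = p @ [d]" "2 \<le> d" "alt_exp xs = p @ [d - 1, 1]"
    using is_cfexp_snocE[OF assms] by metis
  then show ?thesis by (simp add: cf_fin_conv_tail cf_tail_append of_nat_diff)
qed

lemma alt_exp_props:
  assumes "is_cfexp xs"
  shows "positive (alt_exp xs)" "alt_exp xs \<noteq> []" "length (alt_exp xs) = Suc (length xs)"
  using assms by (auto elim!: is_cfexp_snocE)

section \<open>Maximal quadratic intervals\<close>

text \<open>Makes \<open>{gold<..<1}\<close> the half interval of the word \<open>[1]\<close>, so
  that \<open>a = 1\<close> fits the general pattern.\<close>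

lemma cf_per_one: "cf_per [Suc 0] = gold"
proof -
  define b where "b = cf_per [Suc 0]"
  have b: "1 / (1 + b) = b" "0 < b" using cf_per_props[of "[Suc 0]"] by (auto simp: b_def)
  then have "(b + 1/2)\<^sup>2 = 5/4" by (simp add: field_simps power2_eq_square)
  then have "(2 * b + 1)\<^sup>2 = 5" by (simp add: field_simps power2_eq_square)
  then have "sqrt 5 = 2 * b + 1" using b by (metis real_sqrt_unique add_nonneg_nonneg less_imp_le mult_nonneg_nonneg zero_le_numeral zero_le_one)
  then show ?thesis by (simp add: gold_def flip: b_def)
qed

lemma qint_eq:
  assumes "is_cfexp xs"
  shows "qint (cf_fin xs) = open_int (cf_per xs) (cf_per (alt_exp xs))"
  using is_cfexp_cf_fin_less_1[OF assms] cfexp_cf_fin[OF assms] by (simp add: qint_def)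

text \<open>A positive word is one of the two expansions of a rational in (0,1), or
  \<open>[1]\<close>. Such a rational lies between its two periodic endpoints, whereas 1 is itself
  an endpoint of its interval; hence the exception.\<close>

lemma half_int_subset_qint:
  assumes u: "positive u" "u \<noteq> []"
  shows "half_int u \<subseteq> qint (cf_fin u)"
    and "u \<noteq> [1] \<Longrightarrow> cf_fin u \<in> qint (cf_fin u)"
proof -
  have between: "half_int xs \<subseteq> qint (cf_fin xs) \<and> half_int (alt_exp xs) \<subseteq> qint (cf_fin xs) \<and>
    cf_fin xs \<in> qint (cf_fin xs)" if xs: "is_cfexp xs" for xs
  proof -
    note qint_eq[OF xs]
    moreover note alt_exp_props[OF xs] cf_fin_alt_exp[OF xs]
    moreover have "positive xs" "xs \<noteq> []" using xs by (auto simp: is_cfexp_def)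
    ultimately show ?thesis
      using cf_fin_less_cf_per_iff[of xs] cf_fin_less_cf_per_iff[of "alt_exp xs"]
      by (cases "even (length xs)") (auto simp: half_int_def open_int_def)
  qed
  consider "is_cfexp u" | "u = [1]" | xs where "is_cfexp xs" "u = alt_exp xs"
  proof (cases "2 \<le> last u")
    case True
    then show ?thesis using u that(1) by (auto simp: is_cfexp_def)
  next
    case False
    moreover have "0 < last u" using u by auto
    ultimately have "last u = 1" by linarith
    then obtain v where v: "u = v @ [1]" using u by (metis append_butlast_last_id)
    show ?thesis
    proof (cases v rule: rev_cases)
      case Nil
      then show ?thesis using v that(2) by simp
    next
      case (snoc p d)
      \<comment> \<open>Merging the final 1 into the entry before it undoes
        \<open>alt_exp\<close>.\<close>
      then have "is_cfexp (p @ [Suc d])" "u = alt_exp (p @ [Suc d])"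
        using v u by (auto simp: is_cfexp_def alt_exp_def)
      then show ?thesis using that(3) by blast
    qed
  qed
  then have "half_int u \<subseteq> qint (cf_fin u) \<and> (u \<noteq> [1] \<longrightarrow> cf_fin u \<in> qint (cf_fin u))"
  proof cases
    case 2
    have "gold < 1" using cf_per_props[of "[1]"] cf_per_one by simp
    then show ?thesis using 2 cf_per_one
      by (simp add: half_int_def qint_def open_int_def)
  qed (use between cf_fin_alt_exp in auto)
  then show "half_int u \<subseteq> qint (cf_fin u)" "u \<noteq> [1] \<Longrightarrow> cf_fin u \<in> qint (cf_fin u)" by auto
qed

text \<open>The remainder \<open>y = 0\<close> covers the rational itself, which lies in neither
  half interval.\<close>

lemma qint_expand:
  assumes xs: "is_cfexp xs" and x: "x \<in> qint (cf_fin xs)"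
  shows "\<exists>w y. (w = xs \<or> w = alt_exp xs) \<and> x = cf_tail w y \<and> 0 \<le> y \<and> y < x \<and> y < 1"
proof -
  have pos: "positive xs" "xs \<noteq> []" using xs by (auto simp: is_cfexp_def)
  have x1: "x < 1"
    using x cf_per_props[OF pos] cf_per_props[OF alt_exp_props(1,2)[OF xs]]
    by (auto simp: qint_eq[OF xs] open_int_def)
  have "x = cf_fin xs \<or> x \<in> half_int xs \<or> x \<in> half_int (alt_exp xs)"
    using x cf_fin_alt_exp[OF xs] by (auto simp: qint_eq[OF xs] half_int_def open_int_def)
  then consider "x = cf_fin xs" | "x \<in> half_int xs" | "x \<in> half_int (alt_exp xs)" by blast
  then show ?thesis
  proof cases
    case 1
    then have "x = cf_tail xs 0" "0 < x" using cf_tail_pos[of xs 0] pos by (auto simp: cf_fin_conv_tail)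
    then show ?thesis by (metis order_refl zero_less_one)
  next
    case 2
    then obtain y where "0 < y" "y < x" "x = cf_tail xs y" using half_int_iff[OF pos] by blast
    then show ?thesis using x1 by (metis less_imp_le less_trans)
  next
    case 3
    then obtain y where "0 < y" "y < x" "x = cf_tail (alt_exp xs) y"
      using half_int_iff[OF alt_exp_props(1,2)[OF xs]] by blast
    then show ?thesis using x1 by (metis less_imp_le less_trans)
  qed
qed

text \<open>In a shortest counterexample \<open>u\<close> the periodic endpoint lies outside \<open>I\<^sub>a\<close>, since a tail of it
  would otherwise yield a shorter counterexample. Hence \<open>I\<^sub>a\<close> lies between the two endpoints.\<close>

lemma maximal_qint_disjoint_prefix:
  assumes xs: "is_cfexp xs" and max: "cf_fin xs \<in> Rset"
    and u: "u = take i (alt_exp xs)" "0 < i" "i < length (alt_exp xs)"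
  shows "half_int u \<inter> qint (cf_fin xs) = {}"
  using u
proof (induction i arbitrary: u rule: less_induct)
  case (less i)
  have pu: "positive u" "u \<noteq> []" and len: "length u = i"
    using less.prems alt_exp_props[OF xs] by (auto dest: in_set_takeD)
  obtain p d where pd: "xs = p @ [d]" "2 \<le> d" "positive p" "alt_exp xs = p @ [d - 1, 1]"
    using is_cfexp_snocE[OF xs] by metis
  have fin: "cf_fin u \<notin> qint (cf_fin xs)"
  proof
    assume "cf_fin u \<in> qint (cf_fin xs)"
    from qint_expand[OF xs this] obtain w y where
      w: "w = xs \<or> w = alt_exp xs" "cf_fin u = cf_tail w y" and y: "0 \<le> y" "y < 1"
      by blast
    \<comment> \<open>Both expansions start with \<open>p\<close>, and what follows stays strictly
      below \<open>1 / (d - 1)\<close>, the value that the prefix \<open>p @ [d - 1]\<close> would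
      require.\<close>
    obtain z where z: "cf_fin u = cf_tail p z" "0 < z" "z < 1 / real (d - 1)"
    proof -
      have "1 / (real d + y) < 1 / real (d - 1)" 
        using y pd by (intro divide_strict_left_mono) (auto simp: of_nat_diff)
      moreover have "1 / (real (d - 1) + 1 / (1 + y)) < 1 / real (d - 1)"
        using y pd by (intro divide_strict_left_mono) (auto intro!: mult_pos_pos add_pos_pos)
      moreover have "0 < 1 / (real d + y)" "0 < 1 / (real (d - 1) + 1 / (1 + y))"
        using y pd by (auto intro!: add_pos_pos)
      ultimately show ?thesis
        using that[of "1 / (real d + y)"] that[of "1 / (real (d - 1) + 1 / (1 + y))"] w pd
        by (auto simp: cf_tail_append)
    qed
    show False
    proof (cases "i \<le> length p")
      case True
      then have u_eq: "u = take i p" using less.prems pd by simp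
      have "cf_tail u 0 = cf_tail u (cf_tail (drop i p) z)"
        using z by (simp add: u_eq cf_tail_take_drop cf_fin_conv_tail)
      moreover have "0 < cf_tail (drop i p) z"
        using cf_tail_pos[of "drop i p" z] z pd by (auto dest: in_set_dropD)
      ultimately show False using cf_tail_inj[OF pu(1)] by (metis less_irrefl less_imp_le order_refl)
    next
      case False
      then have "i = Suc (length p)" using less.prems pd by simp
      then have "u = p @ [d - 1]" using less.prems pd by simp
      then have "cf_tail p (1 / real (d - 1)) = cf_tail p z"
        using z by (simp add: cf_tail_append cf_fin_conv_tail)
      then show False using cf_tail_inj[OF pd(3), of "1 / real (d - 1)" z] z by simp
    qed
  qed
  have per: "cf_per u \<notin> qint (cf_fin xs)"
  proof
    define b where "b = cf_per u"
    have b: "cf_tail u b = b" "0 < b" "b < 1" using cf_per_props[OF pu] by (auto simp: b_def)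
    assume mem: "cf_per u \<in> qint (cf_fin xs)"
    then obtain w y where w: "w = xs \<or> w = alt_exp xs" "b = cf_tail w y"
      and y: "0 \<le> y" "y < 1" "y < b"
      using qint_expand[OF xs mem] unfolding b_def by blast
    have "positive w" using w(1) xs alt_exp_props[OF xs] by (auto simp: is_cfexp_def)
    then obtain j where j: "j < length u" "y = cf_tail (drop j u) b"
      using cf_tail_eq_periodic_tail[of u b 0 w y] pu b y w by auto
    \<comment> \<open>\<open>j = 0\<close> would give \<open>y = b\<close>, against
      \<open>y < b\<close>. Cutting the period at \<open>j\<close> leaves the remainder
      \<open>y < b\<close>, so \<open>b\<close> lies in the half interval of a shorter
      prefix.\<close>
    have "j \<noteq> 0" using j y b by (intro notI) auto
    have "0 < y" using j b pu cf_tail_pos[of "drop j u" b] by (auto dest: in_set_dropD)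
    let ?v = "take j u"
    have "positive ?v" "?v \<noteq> []" using pu j \<open>j \<noteq> 0\<close> by (auto dest: in_set_takeD)
    moreover have "b = cf_tail ?v y" using j b by (simp add: cf_tail_take_drop)
    ultimately have "b \<in> half_int ?v" using \<open>0 < y\<close> y half_int_iff by blast
    moreover have "half_int ?v \<inter> qint (cf_fin xs) = {}"
      using less.IH[of j ?v] less.prems j len \<open>j \<noteq> 0\<close> by simp
    ultimately show False using mem by (auto simp: b_def)
  qed
  show ?case
  proof (rule ccontr)
    assume "half_int u \<inter> qint (cf_fin xs) \<noteq> {}"
    then have sub: "qint (cf_fin xs) \<subseteq> half_int u"
      using fin per open_int_subset_open_int unfolding qint_eq[OF xs] half_int_def by blast
    \<comment> \<open>\<open>cf_fin u\<close> separates the two intervals. For \<open>[1]\<close>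
      this number is an endpoint, so a point close to 1 is taken instead.\<close>
    have "qint (cf_fin xs) \<noteq> qint (cf_fin u)"
    proof (cases "u = [1]")
      case True
      have "qint (cf_fin u) = {gold<..<1}" using True by (simp add: qint_def)
      moreover have "max gold (max (cf_per xs) (cf_per (alt_exp xs))) < 1"
        using cf_per_less_1[of "[1]"] cf_per_less_1[of xs] cf_per_less_1[of "alt_exp xs"]
          cf_per_one xs alt_exp_props[OF xs] by (simp add: is_cfexp_def)
      then obtain z where "max gold (max (cf_per xs) (cf_per (alt_exp xs))) < z" "z < 1"
        using dense by blast
      then have "z \<in> {gold<..<1}" "z \<notin> qint (cf_fin xs)"
        by (auto simp: qint_eq[OF xs] open_int_def)
      ultimately show ?thesis by blast
    next
      case False
      then show ?thesis using half_int_subset_qint(2)[OF pu] fin by metis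
    qed
    then have "qint (cf_fin xs) \<subset> qint (cf_fin u)"
      using sub half_int_subset_qint(1)[OF pu] by auto
    moreover have "0 < cf_fin u" "cf_fin u \<le> 1"
      using cf_tail_pos[of u 0] cf_tail_le_1[of u 0] pu by (auto simp: cf_fin_conv_tail)
    ultimately show False using max cf_fin_Rats by (auto simp: Rset_def)
  qed
qed

text \<open>A tail below \<open>t\<close> would be a remainder placing \<open>t\<close> in the half
  interval of a proper prefix, although \<open>t\<close> also lies in the maximal interval.\<close>

lemma maximal_tails_ge:
  assumes xs: "is_cfexp xs" and max: "cf_fin xs \<in> Rset"
    and w: "w = xs \<or> w = alt_exp xs"
    and t: "t = cf_tail w s" "0 < s" "s < t"
    and i: "0 < i" "i < length w"
  shows "t \<le> cf_tail (drop i w) s"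
proof (rule ccontr)
  assume less: "\<not> t \<le> cf_tail (drop i w) s"
  have pw: "positive w" "w \<noteq> []" using w xs alt_exp_props[OF xs] by (auto simp: is_cfexp_def)
  let ?u = "take i w"
  have pu: "positive ?u" "?u \<noteq> []" using pw i by (auto dest: in_set_takeD)
  have "0 < cf_tail (drop i w) s" using cf_tail_pos[of "drop i w" s] pw t by (auto dest: in_set_dropD)
  then have "t \<in> half_int ?u"
    using half_int_iff[OF pu] less t by (metis cf_tail_take_drop not_le)
  moreover have "half_int w \<subseteq> qint (cf_fin w)" using half_int_subset_qint[OF pw] by simp
  then have "t \<in> qint (cf_fin xs)"
    using half_int_iff[OF pw, of t] t w cf_fin_alt_exp[OF xs] by (metis subsetD)
  \<comment> \<open>The two expansions share all entries before the last one of \<open>xs\<close>,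
    so a proper prefix of either is a proper prefix of \<open>alt_exp xs\<close>.\<close>
  moreover have "?u = take i (alt_exp xs)" "i < length (alt_exp xs)"
    using w i xs by (auto elim!: is_cfexp_snocE)
  ultimately show False using maximal_qint_disjoint_prefix[OF xs max _ i(1)] by blast
qed

section \<open>Orbits of the two endpoints\<close>

lemma sum_pos_simps [simp]:
  "sum_odd_pos [] = 0" "sum_even_pos [] = 0"
  "sum_odd_pos (x # xs) = x + sum_even_pos xs"
  "sum_even_pos (x # xs) = sum_odd_pos xs"
proof -
  have odd: "{i. i < length (x # xs) \<and> even i} = insert 0 (Suc ` {i. i < length xs \<and> odd i})"
    by (auto simp: image_iff less_Suc_eq_0_disj)
  have even: "{i. i < length (x # xs) \<and> odd i} = Suc ` {i. i < length xs \<and> even i}"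
    by (auto simp: image_iff less_Suc_eq_0_disj)
  show "sum_odd_pos (x # xs) = x + sum_even_pos xs" "sum_even_pos (x # xs) = sum_odd_pos xs"
    unfolding sum_odd_pos_def sum_even_pos_def odd even
    by (subst sum.insert) (auto simp: sum.reindex)
qed (auto simp: sum_odd_pos_def sum_even_pos_def)

lemma sum_pos_append:
  "sum_odd_pos (xs @ ys) = sum_odd_pos xs + (if even (length xs) then sum_odd_pos ys else sum_even_pos ys)"
  "sum_even_pos (xs @ ys) = sum_even_pos xs + (if even (length xs) then sum_even_pos ys else sum_odd_pos ys)"
  by (induction xs) auto

text \<open>Only the piece of \<open>Dset\<close> with \<open>n = k\<close> can contain the point.
  The result does not depend on \<open>k\<close>.\<close>

lemma T_reciprocal:
  assumes "1 \<le> k" "0 < v" "v < 1" "0 < \<alpha>" "\<alpha> < 1"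
  shows "T \<alpha> (1 / (real k + v)) = (if v \<le> \<alpha> then 1 - v else v)"
proof -
  have floor: "\<lfloor>real k + v\<rfloor> = int k" using assms by (simp add: floor_eq_iff)
  have "1 / (real k + v) \<in> Dset \<alpha> \<longleftrightarrow> v \<le> \<alpha>"
  proof
    assume "1 / (real k + v) \<in> Dset \<alpha>"
    then obtain n :: nat where n: "1 \<le> n" "1 / (real n + \<alpha>) \<le> 1 / (real k + v)"
        "1 / (real k + v) \<le> 1 / real n"
      by (auto simp: Dset_def)
    then have le: "real k + v \<le> real n + \<alpha>" "real n \<le> real k + v"
      using assms by (auto simp: divide_simps split: if_splits)
    then have "real n < real (Suc k)" "real k < real (Suc n)" using assms by linarith+
    then have "n = k" unfolding of_nat_less_iff by linarith
    then show "v \<le> \<alpha>" using le by simp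
  next
    assume "v \<le> \<alpha>"
    then show "1 / (real k + v) \<in> Dset \<alpha>"
      using assms unfolding Dset_def by (intro UN_I[of k]) (auto simp: divide_simps)
  qed
  then show ?thesis using assms floor by (simp add: T_def)
qed

lemma one_minus_reciprocal:
  fixes z :: real
  assumes "0 < z"
  shows "1 - 1 / (1 + z) = 1 / (1 + 1 / z)"
  using assms by (simp add: field_simps)

text \<open>Written as \<open>1 / (1 + 1 / (k - 1 + v))\<close>, the point has leading entry 1;
  \<open>2 \<le> k\<close> keeps the inner fraction below 1.\<close>

lemma T_one_minus:
  assumes "2 \<le> k" "0 < v" "v < 1" "0 < \<alpha>" "\<alpha> < 1"
  shows "T \<alpha> (1 - 1 / (real k + v)) =
    (if 1 / (real (k - 1) + v) \<le> \<alpha> then 1 - 1 / (real (k - 1) + v) else 1 / (real (k - 1) + v))"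
proof -
  have "1 - 1 / (1 + (real (k - 1) + v)) = 1 / (1 + 1 / (real (k - 1) + v))"
    using assms by (intro one_minus_reciprocal) auto
  moreover have "1 + (real (k - 1) + v) = real k + v" using assms by (simp add: of_nat_diff)
  moreover have "1 < real (k - 1) + v" using assms by (simp add: of_nat_diff)
  ultimately show ?thesis
    using T_reciprocal[of 1 "1 / (real (k - 1) + v)" \<alpha>] assms by simp
qed

lemma funpow_add_eq:
  assumes "(f ^^ m) x = y" "(f ^^ n) y = z"
  shows "(f ^^ (n + m)) x = z"
  using assms by (simp add: funpow_add)

section \<open>The dynamics for a fixed \<open>\<alpha> = 1 / (1 + t)\<close>\<close>

context
  fixes t \<alpha> :: real
  assumes t: "0 < t" "t < 1" and \<alpha>: "\<alpha> = 1 / (1 + t)"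
begin

lemma alpha_bounds: "1 / 2 < \<alpha>" "0 < \<alpha>" "\<alpha> < 1"
  using t by (auto simp: \<alpha> divide_simps)

text \<open>Decides the branch of \<open>T\<close>: a comparison with \<open>t\<close> is needed
  only at entry 1.\<close>

lemma reciprocal_le_alpha_iff:
  assumes "1 \<le> k" "0 < v"
  shows "1 / (real k + v) \<le> \<alpha> \<longleftrightarrow> 2 \<le> k \<or> t \<le> v"
proof (cases "k = 1")
  case True
  then show ?thesis using assms t by (simp add: \<alpha> divide_simps)
next
  case False
  then have "1 + t \<le> real k + v" using assms t by simp
  then have "1 / (real k + v) \<le> \<alpha>" unfolding \<alpha> using t by (intro divide_left_mono) auto
  then show ?thesis using False assms by simp
qed

text \<open>Every step takes the \<open>Dset\<close> branch and lowers the entry by one; only the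
  step from 2 to 1 requires \<open>t \<le> v\<close>.\<close>

lemma funpow_T_one_minus:
  assumes "1 \<le> j" "j \<le> k" "0 < v" "v < 1" "t \<le> v \<or> 2 \<le> j"
  shows "(T \<alpha> ^^ (k - j)) (1 - 1 / (real k + v)) = 1 - 1 / (real j + v)"
  using assms(2)
proof (induction k rule: dec_induct)
  case (step k)
  have "T \<alpha> (1 - 1 / (real (Suc k) + v)) = 1 - 1 / (real k + v)"
    using step assms alpha_bounds T_one_minus[of "Suc k" v \<alpha>] reciprocal_le_alpha_iff[of k v] by auto
  moreover have "Suc k - j = (k - j) + 1" using step by simp
  ultimately show ?case using step.IH funpow_add_eq[of 1 "T \<alpha>"] by simp
qed simp

text \<open>The countdown runs as before down to 2. Then \<open>1 / (1 + v)\<close> exceeds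
  \<open>\<alpha>\<close>, and the last step takes the other branch.\<close>

lemma funpow_T_one_minus_small:
  assumes "2 \<le> k" "0 < v" "v < t"
  shows "(T \<alpha> ^^ (k - 1)) (1 - 1 / (real k + v)) = 1 / (1 + v)"
proof -
  have "(T \<alpha> ^^ (k - 2)) (1 - 1 / (real k + v)) = 1 - 1 / (real 2 + v)"
    using funpow_T_one_minus[of 2 k v] assms t by simp
  moreover have "(T \<alpha> ^^ 1) (1 - 1 / (real 2 + v)) = 1 / (1 + v)"
    using T_one_minus[of 2 v \<alpha>] reciprocal_le_alpha_iff[of 1 v] alpha_bounds assms t by simp
  ultimately have "(T \<alpha> ^^ (1 + (k - 2))) (1 - 1 / (real k + v)) = 1 / (1 + v)"
    by (rule funpow_add_eq)
  moreover have "1 + (k - 2) = k - 1" using assms by simp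
  ultimately show ?thesis by metis
qed

text \<open>Entries are consumed in pairs. The first is counted down to 1, and
  \<open>1 - 1 / (1 + z) = 1 / (Suc l + x)\<close> has the original shape again with
  \<open>Suc l\<close> as the new \<open>k\<close>. So the second entry costs no steps, and the
  count involves odd positions only.\<close>

lemma funpow_T_reciprocal_cf_tail:
  assumes s: "0 < s" "s < t" "s \<le> \<alpha>"
    and "1 \<le> k" "positive v" "\<And>i. 0 < i \<Longrightarrow> i < length v \<Longrightarrow> t \<le> cf_tail (drop i v) s"
  shows "(T \<alpha> ^^ Suc (sum_odd_pos v)) (1 / (real k + cf_tail v s)) = 1 - s"
  using assms(4-)
proof (induction v arbitrary: k rule: induct_list012)
  case 1
  then show ?case using T_reciprocal[of k s \<alpha>] 1 s t alpha_bounds by simp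
next
  case (2 d)
  \<comment> \<open>With one entry left the remainder is \<open>s < t\<close>, so the countdown ends
    at \<open>1 / (1 + s)\<close> and needs one further step.\<close>
  have last: "T \<alpha> (1 / (1 + s)) = 1 - s" using T_reciprocal[of 1 s \<alpha>] s t alpha_bounds by simp
  have z: "0 < 1 / (real d + s)" "1 / (real d + s) < 1"
    using 2 s by (auto simp: divide_simps Suc_le_eq)
  note first = T_reciprocal[OF \<open>1 \<le> k\<close> z alpha_bounds(2,3)]
  show ?case
  proof (cases "d = 1")
    case True
    then show ?thesis using first last reciprocal_le_alpha_iff[of 1 s] s by (simp add: numeral_2_eq_2)
  next
    case False
    then have d: "2 \<le> d" using 2 by simp
    have "(T \<alpha> ^^ 1) (1 / (real k + 1 / (real d + s))) = 1 - 1 / (real d + s)"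
      using first reciprocal_le_alpha_iff[of d s] d s by simp
    from funpow_add_eq[OF funpow_add_eq[OF this funpow_T_one_minus_small[OF d s(1,2)]], of 1 "1 - s"]
    show ?thesis using last d by simp
  qed
next
  case (3 d l v)
  define x where "x = cf_tail v s"
  define z where "z = 1 / (real l + x)"
  have x: "0 < x" using cf_tail_pos[of v s] 3 s by (simp add: x_def)
  have z: "0 < z" "z < 1" using cf_tail_pos[of "l # v" s] cf_tail_less_1[of "l # v" s] 3 s t
    by (auto simp: z_def x_def)
  have tz: "t \<le> z" using "3.prems"(3)[of 1] by (simp add: z_def x_def)
  have d: "1 \<le> d" using 3 by (simp add: Suc_le_eq)
  have y: "0 < 1 / (real d + z)" "1 / (real d + z) < 1"
    using d z by (auto simp: divide_simps)
  have s1: "(T \<alpha> ^^ 1) (1 / (real k + 1 / (real d + z))) = 1 - 1 / (real d + z)"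
    using T_reciprocal[OF \<open>1 \<le> k\<close> y alpha_bounds(2,3)] reciprocal_le_alpha_iff[of d z] tz d z by simp
  have "1 - 1 / (1 + z) = 1 / (real (Suc l) + x)"
    using one_minus_reciprocal[of z] z by (simp add: z_def add.assoc)
  then have s2: "(T \<alpha> ^^ (d - 1)) (1 - 1 / (real d + z)) = 1 / (real (Suc l) + x)"
    using funpow_T_one_minus[of 1 d z] d z tz by simp
  have s3: "(T \<alpha> ^^ Suc (sum_odd_pos v)) (1 / (real (Suc l) + x)) = 1 - s"
    unfolding x_def
  proof (rule "3.IH"(1))
    show "t \<le> cf_tail (drop i v) s" if "0 < i" "i < length v" for i
      using "3.prems"(3)[of "Suc (Suc i)"] that by simp
  qed (use 3 in auto)
  have "Suc (sum_odd_pos v) + ((d - 1) + 1) = Suc (sum_odd_pos (d # l # v))" using d by simp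
  moreover have "cf_tail (d # l # v) s = 1 / (real d + z)" by (simp add: z_def x_def)
  ultimately show ?case using funpow_add_eq[OF funpow_add_eq[OF s1 s2] s3] by metis
qed

end

text \<open>One orbit lemma serves both points: with \<open>w = k # v\<close>,
  \<open>\<alpha>\<close> is \<open>1 / (1 + cf_tail w s)\<close> and \<open>1 - \<alpha>\<close> is
  \<open>1 / (Suc k + cf_tail v s)\<close>. Dropping \<open>k\<close> turns the even positions of
  \<open>w\<close> into the odd ones of \<open>v\<close>.\<close>

lemma matching:
  assumes w: "positive w" "w \<noteq> []" and \<alpha>: "\<alpha> \<in> open_int (one_fin w) (one_per w)"
    and tails: "\<And>s t i. t = cf_tail w s \<Longrightarrow> 0 < s \<Longrightarrow> s < t \<Longrightarrow> 0 < i \<Longrightarrow> i < length w \<Longrightarrow>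
      t \<le> cf_tail (drop i w) s"
  shows "(T \<alpha> ^^ Suc (sum_odd_pos w)) \<alpha> = (T \<alpha> ^^ Suc (sum_even_pos w)) (1 - \<alpha>)"
proof -
  define t where "t = 1 / \<alpha> - 1"
  have nn: "0 < cf_fin w" "cf_fin w \<le> 1" "0 < cf_per w" "cf_per w < 1"
    using cf_per_props[OF w] cf_tail_pos[of w 0] cf_tail_le_1[of w 0] w by (auto simp: cf_fin_conv_tail)
  then have "0 < one_fin w" "0 < one_per w" by (auto simp: one_fin_def one_per_def)
  then have a0: "0 < \<alpha>" using \<alpha> by (auto simp: open_int_def)
  then have \<alpha>t: "\<alpha> = 1 / (1 + t)" by (simp add: t_def)
  have "t \<in> half_int w"
    using \<alpha> a0 nn
    by (auto simp: half_int_def open_int_def one_fin_def one_per_def t_def min_def max_def field_simps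
        split: if_splits)
  then have "t < 1" using nn by (auto simp: half_int_def open_int_def)
  obtain s where s: "0 < s" "s < t" "t = cf_tail w s"
    using half_int_iff[OF w] \<open>t \<in> half_int w\<close> by auto
  obtain k v where v: "w = k # v" using w by (cases w) auto
  have t0: "0 < t" using s by simp
  have ge: "t \<le> cf_tail (drop i w) s" if "0 < i" "i < length w" for i
    using tails s that by blast
  \<comment> \<open>The first entry is at least 1, so \<open>t * (1 + x) \<le> 1\<close>. With
    \<open>s \<le> x\<close> and \<open>s < t\<close> this gives
    \<open>s * (1 + t) \<le> t + x * t \<le> 1\<close>.\<close>
  have s\<alpha>: "s \<le> \<alpha>"
  proof -
    define x where "x = cf_tail v s"
    have "0 < x" using cf_tail_pos[of v s] w v s by (simp add: x_def)
    moreover have "1 \<le> real k" using w v by (simp add: Suc_le_eq)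
    ultimately have "t \<le> 1 / (1 + x)" unfolding s(3) v cf_tail.simps x_def[symmetric]
      by (intro divide_left_mono) auto
    then have tx: "t + t * x \<le> 1" using \<open>0 < x\<close> by (simp add: pos_le_divide_eq algebra_simps)
    have "s \<le> x"
      using ge[of 1] s(1,2) v by (cases "v = []") (auto simp: x_def)
    then have "s * t \<le> x * t" using t0 by (intro mult_right_mono) auto
    then have "s * (1 + t) \<le> 1" using tx s(2) by (simp add: algebra_simps)
    then show ?thesis using t0 by (simp add: \<alpha>t pos_le_divide_eq)
  qed
  have "(T \<alpha> ^^ Suc (sum_odd_pos w)) (1 / (real 1 + cf_tail w s)) = 1 - s"
    using funpow_T_reciprocal_cf_tail[OF t0 \<open>t < 1\<close> \<alpha>t s(1,2) s\<alpha> _ w(1) ge, of 1] by simp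
  moreover have "(T \<alpha> ^^ Suc (sum_odd_pos v)) (1 / (real (Suc k) + cf_tail v s)) = 1 - s"
  proof (rule funpow_T_reciprocal_cf_tail[OF t0 \<open>t < 1\<close> \<alpha>t s(1,2) s\<alpha>])
    show "t \<le> cf_tail (drop i v) s" if "0 < i" "i < length v" for i
      using ge[of "Suc i"] that v by simp
  qed (use w v in auto)
  moreover have "1 - \<alpha> = 1 / (real (Suc k) + cf_tail v s)"
    using one_minus_reciprocal[OF t0] s(3) v by (simp add: \<alpha>t add.assoc)
  ultimately show ?thesis using s(3) v by (simp add: \<alpha>t del: funpow.simps)
qed

lemma open_int_commute: "open_int x y = open_int y x"
  by (simp add: open_int_def min.commute max.commute)

theorem theorem3p5:
  fixes a :: real
  assumes "a \<in> Rset"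
  shows "(\<forall>\<alpha>\<in>JL a. (T \<alpha> ^^ Mv a) \<alpha> = (T \<alpha> ^^ Nv a) (1 - \<alpha>))
       \<and> (\<forall>\<alpha>\<in>JR a. (T \<alpha> ^^ (Mv a + 1)) \<alpha> = (T \<alpha> ^^ (Nv a - 1)) (1 - \<alpha>))"
proof (cases "a = 1")
  case True
  have gold: "1 / (1 + gold) = gold" "0 < gold" "gold < 1"
    using cf_per_props[of "[1]"] by (auto simp: cf_per_one)
  then have "1 / 2 < 1 / (1 + gold)" by (intro divide_strict_left_mono) auto
  then have "1 / 2 < gold" "gold = one_per [1]" using gold by (auto simp: one_per_def cf_per_one)
  \<comment> \<open>For \<open>a = 1\<close> the word \<open>[1]\<close> of odd length plays the
    role of the expansion.\<close>
  then have "JR a = open_int (one_fin [1]) (one_per [1])"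
    using True by (simp add: JR_def open_int_def one_fin_def)
  then show ?thesis
    using True matching[of "[1]"] by (simp add: JL_def Mv_def Nv_def numeral_2_eq_2 del: funpow.simps)
next
  case False
  define xs where "xs = cfexp a"
  have "a \<in> \<rat>" "0 < a" "a < 1" using assms False by (auto simp: Rset_def)
  then have xs: "is_cfexp xs" "cf_fin xs = a" using cfexp_props by (auto simp: xs_def)
  have m: "(T \<alpha> ^^ Suc (sum_odd_pos w)) \<alpha> = (T \<alpha> ^^ Suc (sum_even_pos w)) (1 - \<alpha>)"
    if w: "w = xs \<or> w = alt_exp xs" and "\<alpha> \<in> open_int (one_fin w) (one_per w)" for w \<alpha>
  proof (rule matching)
    show "positive w" "w \<noteq> []" using w xs alt_exp_props[OF xs(1)] by (auto simp: is_cfexp_def)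
    show "t \<le> cf_tail (drop i w) s"
      if "t = cf_tail w s" "0 < s" "s < t" "0 < i" "i < length w" for s t i
      using maximal_tails_ge[OF xs(1) _ w] xs assms that by simp
  qed fact
  obtain p d where pd: "xs = p @ [d]" "2 \<le> d" "alt_exp xs = p @ [d - 1, 1]"
    using is_cfexp_snocE[OF xs(1)] by metis
  show ?thesis
  proof (cases "odd (length xs)")
    case True
    have J: "JL a = open_int (one_fin (alt_exp xs)) (one_per (alt_exp xs))"
      "JR a = open_int (one_fin xs) (one_per xs)"
      using True False by (simp_all add: JL_def JR_def Let_def open_int_commute flip: xs_def)
    \<comment> \<open>For odd length, passing to \<open>alt_exp\<close> lowers the odd sum by 1 and
      raises the even sum by 1.\<close>
    have "Mv a = Suc (sum_odd_pos (alt_exp xs))" "Nv a = Suc (sum_even_pos (alt_exp xs))"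
      "Mv a + 1 = Suc (sum_odd_pos xs)" "Nv a - 1 = Suc (sum_even_pos xs)"
      using True False pd by (simp_all add: Mv_def Nv_def Let_def sum_pos_append flip: xs_def)
    then show ?thesis unfolding J using m by metis
  next
    case even: False
    have J: "JL a = open_int (one_fin xs) (one_per xs)"
      "JR a = open_int (one_fin (alt_exp xs)) (one_per (alt_exp xs))"
      using even False by (simp_all add: JL_def JR_def Let_def open_int_commute flip: xs_def)
    \<comment> \<open>For even length the split last entry stands at an even position, so the two
      sums change the other way.\<close>
    have "Mv a = Suc (sum_odd_pos xs)" "Nv a = Suc (sum_even_pos xs)"
      "Mv a + 1 = Suc (sum_odd_pos (alt_exp xs))" "Nv a - 1 = Suc (sum_even_pos (alt_exp xs))"
      using even False pd by (simp_all add: Mv_def Nv_def Let_def sum_pos_append flip: xs_def)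
    then show ?thesis unfolding J using m by metis
  qed
qed

end
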